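(* Let a decomposable POMDP with $M$ components and horizon $T$ be given. Let $v_M^*=\max_{\delta\in\Delta}\mathbb{E}_\delta\big[\sum_{t=1}^T\sum_{m=1}^M r_m(S_t^m,A_t,S_{t+1}^m)\big]$, where $\Delta$ is the set of memoryless policies depending on the current full observation, and let $z_M^*$ be the optimal value of the linear program (LP) defined in the context. Then (LP) is a relaxation of the problem defining $v_M^*$ (for every $\delta\in\Delta$ there is a feasible $\tau$ of (LP) whose objective value is at least the expected total reward of $\delta$), and $$v_M^*\le z_M^*.$$
   Context: Notation: $[N]=\{1,\dots,N\}$. A decomposable POMDP with $M$ components and horizon $T$ consists of finite nonempty sets $\mathcal{X}_S^m,\mathcal{X}_O^m$ ($m\in[M]$) and $\mathcal{X}_A$, initial distributions $p_m(s)$ on $\mathcal{X}_S^m$, emission probabilities $p_m(o|s)$, transition probabilities $p_m(s'|s,a)$, and rewards $r_m:\mathcal{X}_S^m\times\mathcal{X}_A\times\mathcal{X}_S^m\to\mathbb{R}$. The system has state space $\mathcal{X}_S=\prod_m\mathcal{X}_S^m$, observation space $\mathcal{X}_O=\prod_m\mathcal{X}_O^m$, and $\mathbb{P}(\mathbf{S}_1=\mathbf{s})=\prod_m p_m(s^m)$, $\mathbb{P}(\mathbf{O}_t=\mathbf{o}|\mathbf{S}_t=\mathbf{s})=\prod_m p_m(o^m|s^m)$, $\mathbb{P}(\mathbf{S}_{t+1}=\mathbf{s}'|\mathbf{S}_t=\mathbf{s},A_t=a)=\prod_m p_m(s'^m|s^m,a)$, where $\mathbf{S}_t=(S_t^1,\dots,S_t^M)$,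 $\mathbf{O}_t=(O_t^1,\dots,O_t^M)$. Policies: $\Delta=\{\delta=(\delta^t_{a|\mathbf{o}}):\ \sum_{a\in\mathcal{X}_A}\delta^t_{a|\mathbf{o}}=1,\ \delta^t_{a|\mathbf{o}}\ge 0\ \forall \mathbf{o}\in\mathcal{X}_O,a\in\mathcal{X}_A,t\in[T]\}$. Under $\mathbb{P}_\delta$ (expectation $\mathbb{E}_\delta$), at each $t\in[T]$ the action $A_t$ is drawn from $\delta^t_{\cdot|\mathbf{O}_t}$. (LP): over variables $\tau=\big(((\tau_s^{t,m})_s,(\tau_{sa}^{t,m})_{s,a},(\tau_{soa}^{t,m})_{s,o,a})_{m\in[M]},(\tau_a^t)_a\big)_t$ (with $\tau_s^{t,m}$ for $t\in[T+1]$ and the others for $t\in[T]$; $s\in\mathcal{X}_S^m$, $o\in\mathcal{X}_O^m$, $a\in\mathcal{X}_A$), maximize $\sum_{t=1}^T\sum_{m=1}^M\sum_{s,s'\in\mathcal{X}_S^m,\,a\in\mathcal{X}_A}r_m(s,a,s')\,p_m(s'|s,a)\,\tau_{sa}^{t,m}$ subject to, for all $m\in[M]$, $t\in[T]$, $s,s'\in\mathcal{X}_S^m$, $o\in\mathcal{X}_O^m$, $a\in\mathcal{X}_A$: - $\tau_{s'}^{t+1,m}=\sum_{s\in\mathcal{X}_S^m,a\in\mathcal{X}_A}p_m(s'|s,a)\tau_{sa}^{t,m}$; - $\tau_{sa}^{t,m}=\sum_{o\in\mathcal{X}_O^m}\tau_{soa}^{t,m}$; - $\sum_{s\in\mathcal{X}_S^m}\tau_{sa}^{t,m}=\tau_a^t$;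 - $\sum_{a\in\mathcal{X}_A}\tau_{soa}^{t,m}=p_m(o|s)\tau_s^{t,m}$; - $\tau_s^{1,m}=p_m(s)$; - $\tau\ge 0$. *)

theory Defs
  imports "HOL-Probability.Probability" "HOL-Library.Monad_Syntax"
begin

text \<open>
  Components are indexed by \<open>{1..M}\<close> and times by \<open>{1..T}\<close> (states also at time \<open>T + 1\<close>).
  The component spaces are finite subsets of common carrier types, and all probabilities are
  PMFs supported on these subsets.
\<close>

record ('s, 'o, 'a) dpomdp =
  num_components :: nat
  horizon :: nat
  states :: "nat \<Rightarrow> 's set"
  observations :: "nat \<Rightarrow> 'o set"
  actions :: "'a set"
  init :: "nat \<Rightarrow> 's pmf"
  emission :: "nat \<Rightarrow> 's \<Rightarrow> 'o pmf"
  transition :: "nat \<Rightarrow> 's \<Rightarrow> 'a \<Rightarrow> 's pmf"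
  reward :: "nat \<Rightarrow> 's \<Rightarrow> 'a \<Rightarrow> 's \<Rightarrow> real"

definition decomposable_pomdp :: "('s, 'o, 'a) dpomdp \<Rightarrow> bool" where
  "decomposable_pomdp P \<longleftrightarrow>
     finite (actions P) \<and> actions P \<noteq> {} \<and>
     (\<forall>m\<in>{1..num_components P}.
        finite (states P m) \<and> states P m \<noteq> {} \<and>
        finite (observations P m) \<and> observations P m \<noteq> {} \<and>
        set_pmf (init P m) \<subseteq> states P m \<and>
        (\<forall>s\<in>states P m. set_pmf (emission P m s) \<subseteq> observations P m) \<and>
        (\<forall>s\<in>states P m. \<forall>a\<in>actions P. set_pmf (transition P m s a) \<subseteq> states P m))"

text \<open>
  A joint state or observation is an extensional function on \<open>{1..M}\<close>; \<open>Pi_pmf\<close> gives the product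
  distribution on such functions.
\<close>

definition joint_observations :: "('s, 'o, 'a) dpomdp \<Rightarrow> (nat \<Rightarrow> 'o) set" where
  "joint_observations P = (\<Pi>\<^sub>E m\<in>{1..num_components P}. observations P m)"

definition joint_init :: "('s, 'o, 'a) dpomdp \<Rightarrow> (nat \<Rightarrow> 's) pmf" where
  "joint_init P = Pi_pmf {1..num_components P} undefined (init P)"

definition joint_emission :: "('s, 'o, 'a) dpomdp \<Rightarrow> (nat \<Rightarrow> 's) \<Rightarrow> (nat \<Rightarrow> 'o) pmf" where
  "joint_emission P s = Pi_pmf {1..num_components P} undefined (\<lambda>m. emission P m (s m))"

definition joint_transition ::
    "('s, 'o, 'a) dpomdp \<Rightarrow> (nat \<Rightarrow> 's) \<Rightarrow> 'a \<Rightarrow> (nat \<Rightarrow> 's) pmf" where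
  "joint_transition P s a =
     Pi_pmf {1..num_components P} undefined (\<lambda>m. transition P m (s m) a)"

type_synonym ('o, 'a) policy = "nat \<Rightarrow> (nat \<Rightarrow> 'o) \<Rightarrow> 'a pmf"

definition policies :: "('s, 'o, 'a) dpomdp \<Rightarrow> ('o, 'a) policy set" where
  "policies P =
     {\<delta>. \<forall>t\<in>{1..horizon P}. \<forall>ob\<in>joint_observations P. set_pmf (\<delta> t ob) \<subseteq> actions P}"

text \<open>
  \<open>run P \<delta> k\<close> is the joint law of \<open>S\<^sub>1, \<dots>, S\<^sub>k\<^sub>+\<^sub>1\<close>, \<open>O\<^sub>1, \<dots>, O\<^sub>k\<close> and \<open>A\<^sub>1, \<dots>, A\<^sub>k\<close>; the three
  sequences are functions of time, \<open>undefined\<close> at the times not yet generated.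
\<close>

type_synonym ('s, 'o, 'a) trajectory =
  "(nat \<Rightarrow> nat \<Rightarrow> 's) \<times> (nat \<Rightarrow> nat \<Rightarrow> 'o) \<times> (nat \<Rightarrow> 'a)"

primrec run ::
    "('s, 'o, 'a) dpomdp \<Rightarrow> ('o, 'a) policy \<Rightarrow> nat \<Rightarrow> ('s, 'o, 'a) trajectory pmf" where
  "run P \<delta> 0 =
     map_pmf (\<lambda>s. ((\<lambda>_. undefined)(1 := s), (\<lambda>_. undefined), (\<lambda>_. undefined))) (joint_init P)"
| "run P \<delta> (Suc k) =
     do {
       (S, Ob, A) \<leftarrow> run P \<delta> k;
       ob \<leftarrow> joint_emission P (S (Suc k));
       a \<leftarrow> \<delta> (Suc k) ob;
       s' \<leftarrow> joint_transition P (S (Suc k)) a;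
       return_pmf (S(Suc (Suc k) := s'), Ob(Suc k := ob), A(Suc k := a))
     }"

definition expected_reward :: "('s, 'o, 'a) dpomdp \<Rightarrow> ('o, 'a) policy \<Rightarrow> real" where
  "expected_reward P \<delta> =
     measure_pmf.expectation (run P \<delta> (horizon P))
       (\<lambda>(S, Ob, A). \<Sum>t=1..horizon P. \<Sum>m=1..num_components P.
          reward P m (S t m) (A t) (S (t + 1) m))"

definition v_star :: "('s, 'o, 'a) dpomdp \<Rightarrow> real" where
  "v_star P = (GREATEST v. v \<in> expected_reward P ` policies P)"

text \<open>
  The LP variables take the time first, then the component.  Their values outside the index ranges
  are unconstrained and do not enter the objective.
\<close>

record ('s, 'o, 'a) lp_vars =
  tau_s :: "nat \<Rightarrow> nat \<Rightarrow> 's \<Rightarrow> real"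
  tau_sa :: "nat \<Rightarrow> nat \<Rightarrow> 's \<Rightarrow> 'a \<Rightarrow> real"
  tau_soa :: "nat \<Rightarrow> nat \<Rightarrow> 's \<Rightarrow> 'o \<Rightarrow> 'a \<Rightarrow> real"
  tau_a :: "nat \<Rightarrow> 'a \<Rightarrow> real"

definition lp_objective :: "('s, 'o, 'a) dpomdp \<Rightarrow> ('s, 'o, 'a) lp_vars \<Rightarrow> real" where
  "lp_objective P \<tau> =
     (\<Sum>t=1..horizon P. \<Sum>m=1..num_components P.
        \<Sum>s\<in>states P m. \<Sum>s'\<in>states P m. \<Sum>a\<in>actions P.
          reward P m s a s' * pmf (transition P m s a) s' * tau_sa \<tau> t m s a)"

definition lp_nonneg :: "('s, 'o, 'a) dpomdp \<Rightarrow> ('s, 'o, 'a) lp_vars \<Rightarrow> bool" where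
  "lp_nonneg P \<tau> \<longleftrightarrow>
     (\<forall>m\<in>{1..num_components P}. \<forall>t\<in>{1..horizon P + 1}. \<forall>s\<in>states P m. 0 \<le> tau_s \<tau> t m s) \<and>
     (\<forall>m\<in>{1..num_components P}. \<forall>t\<in>{1..horizon P}. \<forall>s\<in>states P m. \<forall>a\<in>actions P.
        0 \<le> tau_sa \<tau> t m s a \<and> (\<forall>ob\<in>observations P m. 0 \<le> tau_soa \<tau> t m s ob a)) \<and>
     (\<forall>t\<in>{1..horizon P}. \<forall>a\<in>actions P. 0 \<le> tau_a \<tau> t a)"

definition lp_feasible :: "('s, 'o, 'a) dpomdp \<Rightarrow> ('s, 'o, 'a) lp_vars set" where
  "lp_feasible P =
     {\<tau>. lp_nonneg P \<tau> \<and>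
       (\<forall>m\<in>{1..num_components P}.
          (\<forall>s\<in>states P m. tau_s \<tau> 1 m s = pmf (init P m) s) \<and>
          (\<forall>t\<in>{1..horizon P}.
             (\<forall>s'\<in>states P m. tau_s \<tau> (t + 1) m s' =
                (\<Sum>s\<in>states P m. \<Sum>a\<in>actions P. pmf (transition P m s a) s' * tau_sa \<tau> t m s a)) \<and>
             (\<forall>s\<in>states P m. \<forall>a\<in>actions P.
                tau_sa \<tau> t m s a = (\<Sum>ob\<in>observations P m. tau_soa \<tau> t m s ob a)) \<and>
             (\<forall>a\<in>actions P. (\<Sum>s\<in>states P m. tau_sa \<tau> t m s a) = tau_a \<tau> t a) \<and>
             (\<forall>s\<in>states P m. \<forall>ob\<in>observations P m.
                (\<Sum>a\<in>actions P. tau_soa \<tau> t m s ob a) = pmf (emission P m s) ob * tau_s \<tau> t m s)))}"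

definition z_star :: "('s, 'o, 'a) dpomdp \<Rightarrow> real" where
  "z_star P = (GREATEST z. z \<in> lp_objective P ` lp_feasible P)"

end

theory Submission
  imports Defs
begin

text \<open>
  A policy \<open>\<delta>\<close> induces a point of the LP: let \<open>\<tau>\<close> be the probabilities, under \<open>\<delta>\<close>, of the local
  events \<open>S\<^sub>t\<^sup>m = s\<close>, \<open>(S\<^sub>t\<^sup>m, A\<^sub>t) = (s, a)\<close>, \<open>(S\<^sub>t\<^sup>m, O\<^sub>t\<^sup>m, A\<^sub>t) = (s, o, a)\<close> and \<open>A\<^sub>t = a\<close>.  Apart
  from nonnegativity and the initial law, every LP constraint is then one of three things: the law
  of total probability; the fact that, given the joint state, the observation of component \<open>m\<close>
  depends only on the state of component \<open>m\<close> (\<open>run_emission\<close>); or the same fact for the next state,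
  given the joint state and the action (\<open>run_transition\<close>).  The last two are where the product form of the joint kernels enters: the
  \<open>m\<close>-th marginal of a product law is its \<open>m\<close>-th factor.  By linearity of expectation the
  objective at this point is exactly the expected reward (\<open>occupation_objective\<close>).  The LP is only a
  relaxation because a feasible \<open>\<tau>\<close> need not come from a policy: nothing in it makes the action
  independent of the hidden state given the observation.

  Both optimal values have to be attained before they can be compared.

  For policies, one decision is used at most once along a trajectory, namely the action chosen at
  a time \<open>t\<close> after an observation \<open>ob\<close>.  Hence the law of a trajectory is the mixture, with
  weights \<open>\<delta> t ob\<close>, of the laws obtained by committing to one action there (\<open>run_mixture\<close>), and some
  commitment does at least as well as the average.  Committing everywhere shows that the finitely
  many deterministic policies contain an optimal one (\<open>optimal_policy_exists\<close>).

  For the LP, the variables \<open>\<tau>\<^sub>s\<^sub>o\<^sub>a\<close> determine all the others through the equality constraints, and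
  they lie between 0 and 1 because the \<open>\<tau>\<^sub>s\<close> of one component and one time sum to 1.  The feasible
  set is therefore parametrised by a compact set of vectors \<open>\<tau>\<^sub>s\<^sub>o\<^sub>a\<close> on which the objective is
  continuous (\<open>lp_optimum_exists\<close>).
\<close>

section \<open>Finite maxima and discrete laws\<close>

lemma finite_attains_max:
  fixes f :: "'b \<Rightarrow> real"
  assumes "finite S" "S \<noteq> {}"
  obtains x where "x \<in> S" "\<And>y. y \<in> S \<Longrightarrow> f y \<le> f x"
  using ex_is_arg_min_if_finite[OF assms, of "\<lambda>x. - f x"] that
  by (auto simp: is_arg_min_linorder)

text \<open>
  The law of total probability for \<open>f\<close>, split along a finitely valued \<open>g\<close>.  The map \<open>h\<close> stands for the
  pair of \<open>f\<close> and \<open>g\<close> in whatever tuple nesting is convenient, \<open>c x\<close> being the tuple that encodes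
  \<open>f = y\<close> and \<open>g = x\<close>.
\<close>
lemma pmf_marginal:
  assumes "finite B" and "\<And>z. z \<in> set_pmf p \<Longrightarrow> g z \<in> B"
    and split: "\<And>z x. x \<in> B \<Longrightarrow> h z = c x \<longleftrightarrow> f z = y \<and> g z = x"
  shows "pmf (map_pmf f p) y = (\<Sum>x\<in>B. pmf (map_pmf h p) (c x))"
proof -
  have "pmf (map_pmf f p) y = measure_pmf.prob p (\<Union>x\<in>B. h -` {c x})"
    unfolding pmf_map using assms(2) split
    by (intro measure_pmf.finite_measure_eq_AE) (auto simp: AE_measure_pmf_iff)
  also have "\<dots> = (\<Sum>x\<in>B. measure_pmf.prob p (h -` {c x}))"
    using assms(1)
  proof (intro measure_pmf.finite_measure_finite_Union)
    show "disjoint_family_on (\<lambda>x. h -` {c x}) B"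
      unfolding disjoint_family_on_def using split by (metis (no_types) disjoint_iff vimage_singleton_eq)
  qed auto
  finally show ?thesis
    by (simp add: pmf_map)
qed

lemma pmf_bind_map_Pair:
  "pmf (bind_pmf p (\<lambda>x. map_pmf (Pair x) (K x))) (x, y) = pmf p x * pmf (K x) y"
proof -
  have "pmf (map_pmf (Pair x') (K x')) (x, y) = indicator {x} x' * pmf (K x) y" for x'
    by (auto simp: pmf_map indicator_def vimage_def pmf.rep_eq)
  then show ?thesis
    by (simp add: pmf_bind measure_pmf_single)
qed

section \<open>Local Markov structure of a run\<close>

text \<open>
  Extending a run by one step does not change the law of what has already happened; this reduces
  statements about time \<open>t\<close> in a long run to the run that has just generated time \<open>t\<close>.
\<close>
lemma run_past:
  assumes "\<And>S Ob A s ob a.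
    f (S(Suc (Suc n) := s), Ob(Suc n := ob), A(Suc n := a)) = f (S, Ob, A)"
  shows "map_pmf f (run P \<delta> (Suc n)) = map_pmf f (run P \<delta> n)"
  by (simp add: map_bind_pmf case_prod_beta assms bind_pmf_const) (simp add: map_pmf_def)

lemma Pi_pmf_marginal:
  fixes m M :: nat
  assumes "m \<in> {1..M}"
  shows "map_pmf (\<lambda>f. f m) (Pi_pmf {1..M} d p) = p m"
  using assms by (simp add: Pi_pmf_component)

text \<open>
  Given the state of component \<open>m\<close>, its observation is drawn from its own emission law.  The other
  components are integrated out of the product emission law.
\<close>
lemma run_emission:
  assumes m: "m \<in> {1..num_components P}" and "k < n"
  shows "map_pmf (\<lambda>(S, Ob, A). (S (Suc k) m, Ob (Suc k) m)) (run P \<delta> n) =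
    map_pmf (\<lambda>(S, Ob, A). S (Suc k) m) (run P \<delta> n) \<bind> (\<lambda>x. map_pmf (Pair x) (emission P m x))"
  using \<open>k < n\<close>
proof (induction n)
  case (Suc n)
  show ?case
  proof (cases "k < n")
    case True
    then show ?thesis
      using Suc.IH by (subst (1 2) run_past) (auto simp: case_prod_unfold)
  next
    case False
    with Suc.prems have k: "k = n" by simp
    have em: "map_pmf (\<lambda>ob. (x, ob m)) (joint_emission P s) = map_pmf (Pair x) (emission P m (s m))"
      for x s
      unfolding joint_emission_def
      by (subst Pi_pmf_marginal[OF m, symmetric, where p = "\<lambda>m. emission P m (s m)" and d = undefined])
        (simp add: map_pmf_comp)
    have "map_pmf (\<lambda>(S, Ob, A). (S (Suc k) m, Ob (Suc k) m)) (run P \<delta> (Suc n)) =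
      run P \<delta> n \<bind> (\<lambda>(S, Ob, A). map_pmf (\<lambda>ob. (S (Suc n) m, ob m)) (joint_emission P (S (Suc n))))"
      by (simp add: k map_bind_pmf case_prod_beta bind_pmf_const) (simp add: map_pmf_def case_prod_unfold)
    also have "\<dots> = map_pmf (\<lambda>(S, Ob, A). S (Suc k) m) (run P \<delta> n) \<bind> (\<lambda>x. map_pmf (Pair x) (emission P m x))"
      by (simp add: k em bind_map_pmf case_prod_unfold)
    also have "map_pmf (\<lambda>(S, Ob, A). S (Suc k) m) (run P \<delta> n) = map_pmf (\<lambda>(S, Ob, A). S (Suc k) m) (run P \<delta> (Suc n))"
      by (subst run_past) (auto simp: k)
    finally show ?thesis .
  qed
qed simp

text \<open>
  The action depends on all components through the joint observation, so the current local state
  and the action are correlated in a policy-dependent way; the next local state is still drawn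
  from the local kernel at that pair, because the joint transition law is a product once the joint
  state and the action are known.
\<close>
lemma run_transition:
  assumes m: "m \<in> {1..num_components P}" and "k < n"
  shows "map_pmf (\<lambda>(S, Ob, A). ((S (Suc k) m, A (Suc k)), S (Suc (Suc k)) m)) (run P \<delta> n) =
    map_pmf (\<lambda>(S, Ob, A). (S (Suc k) m, A (Suc k))) (run P \<delta> n) \<bind>
      (\<lambda>x. map_pmf (Pair x) (transition P m (fst x) (snd x)))"
  using \<open>k < n\<close>
proof (induction n)
  case (Suc n)
  show ?case
  proof (cases "k < n")
    case True
    then show ?thesis
      using Suc.IH by (subst (1 2) run_past) (auto simp: case_prod_unfold)
  next
    case False
    with Suc.prems have k: "k = n" by simp
    have tr: "map_pmf (\<lambda>s'. (x, s' m)) (joint_transition P s a) = map_pmf (Pair x) (transition P m (s m) a)"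
      for x s a
      unfolding joint_transition_def
      by (subst Pi_pmf_marginal[OF m, symmetric, where p = "\<lambda>m. transition P m (s m) a" and d = undefined])
        (simp add: map_pmf_comp)
    have "map_pmf (\<lambda>(S, Ob, A). ((S (Suc k) m, A (Suc k)), S (Suc (Suc k)) m)) (run P \<delta> (Suc n)) =
      run P \<delta> n \<bind> (\<lambda>(S, Ob, A). joint_emission P (S (Suc n)) \<bind> (\<lambda>ob. \<delta> (Suc n) ob \<bind> (\<lambda>a.
        map_pmf (\<lambda>s'. ((S (Suc n) m, a), s' m)) (joint_transition P (S (Suc n)) a))))"
      by (simp add: k map_bind_pmf case_prod_beta) (simp add: map_pmf_def case_prod_unfold)
    also have "\<dots> = map_pmf (\<lambda>(S, Ob, A). (S (Suc k) m, A (Suc k))) (run P \<delta> (Suc n)) \<bind>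
      (\<lambda>x. map_pmf (Pair x) (transition P m (fst x) (snd x)))"
      by (simp add: k tr map_bind_pmf bind_map_pmf bind_assoc_pmf case_prod_unfold bind_pmf_const)
        (simp add: bind_return_pmf)
    finally show ?thesis .
  qed
qed simp

section \<open>Two constructions of LP points\<close>

definition occupation :: "('s, 'o, 'a) dpomdp \<Rightarrow> ('o, 'a) policy \<Rightarrow> ('s, 'o, 'a) lp_vars" where
  "occupation P \<delta> = (let R = run P \<delta> (horizon P) in
     \<lparr>tau_s = (\<lambda>t m s. pmf (map_pmf (\<lambda>(S, Ob, A). S t m) R) s),
      tau_sa = (\<lambda>t m s a. pmf (map_pmf (\<lambda>(S, Ob, A). (S t m, A t)) R) (s, a)),
      tau_soa = (\<lambda>t m s ob a. pmf (map_pmf (\<lambda>(S, Ob, A). (S t m, Ob t m, A t)) R) (s, ob, a)),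
      tau_a = (\<lambda>t a. pmf (map_pmf (\<lambda>(S, Ob, A). A t) R) a)\<rparr>)"

text \<open>
  The only candidate for a feasible LP point with given \<open>\<tau>\<^sub>s\<^sub>o\<^sub>a\<close>: each remaining variable is read off
  the equality constraint that has it alone on one side.  The constraints for \<open>\<tau>\<^sub>a\<close> repeat the same
  value once per component, and the first component supplies it.
\<close>
definition lp_extend ::
    "('s, 'o, 'a) dpomdp \<Rightarrow> (nat \<times> nat \<times> 's \<times> 'o \<times> 'a \<Rightarrow> real) \<Rightarrow> ('s, 'o, 'a) lp_vars" where
  "lp_extend P x = (let sa = (\<lambda>t m s a. \<Sum>ob\<in>observations P m. x (t, m, s, ob, a)) in
     \<lparr>tau_s = (\<lambda>t m s'. if t = 1 then pmf (init P m) s' else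
        (\<Sum>s\<in>states P m. \<Sum>a\<in>actions P. pmf (transition P m s a) s' * sa (t - 1) m s a)),
      tau_sa = sa,
      tau_soa = (\<lambda>t m s ob a. x (t, m, s, ob, a)),
      tau_a = (\<lambda>t a. \<Sum>s\<in>states P 1. sa t 1 s a)\<rparr>)"

lemma lp_extend_continuous:
  "continuous_on UNIV (\<lambda>x. tau_s (lp_extend P x) t m s)"
  "continuous_on UNIV (\<lambda>x. tau_sa (lp_extend P x) t m s a)"
  "continuous_on UNIV (\<lambda>x. tau_soa (lp_extend P x) t m s ob a)"
  "continuous_on UNIV (\<lambda>x. tau_a (lp_extend P x) t a)"
  unfolding lp_extend_def Let_def
  by (cases "t = 1"; simp; intro continuous_intros continuous_on_product_coordinates)+

lemma closed_Collect_Ball: "(\<And>i. i \<in> I \<Longrightarrow> closed {x. Q i x}) \<Longrightarrow> closed {x. \<forall>i\<in>I. Q i x}"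
  by (simp add: Collect_ball_eq closed_INT)

lemma lp_extend_feasible_closed: "closed {x. lp_extend P x \<in> lp_feasible P}"
  unfolding lp_feasible_def lp_nonneg_def mem_Collect_eq
  by (intro closed_Collect_conj closed_Collect_Ball closed_Collect_eq closed_Collect_le
      continuous_intros lp_extend_continuous)

lemma lp_objective_extend_continuous: "continuous_on UNIV (\<lambda>x. lp_objective P (lp_extend P x))"
  unfolding lp_objective_def by (intro continuous_intros lp_extend_continuous)

text \<open>Tychonoff's theorem for boxes of functions.\<close>
lemma compact_Pi_UNIV:
  fixes C :: "'i \<Rightarrow> real set"
  assumes "\<And>i. compact (C i)"
  shows "compact (Pi UNIV C)"
  using assms compactin_PiE[of "\<lambda>_. euclidean" UNIV C] by (simp add: euclidean_product_topology PiE_UNIV_domain)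

section \<open>Support of a run\<close>

definition joint_states :: "('s, 'o, 'a) dpomdp \<Rightarrow> (nat \<Rightarrow> 's) set" where
  "joint_states P = (\<Pi>\<^sub>E m\<in>{1..num_components P}. states P m)"

context
  fixes P :: "('s, 'o, 'a) dpomdp"
  assumes pomdp: "decomposable_pomdp P"
begin

private abbreviation "M \<equiv> num_components P"
private abbreviation "T \<equiv> horizon P"
private abbreviation "JO \<equiv> joint_observations P"

lemma finite_actions: "finite (actions P)" "actions P \<noteq> {}"
  and finite_states: "m \<in> {1..M} \<Longrightarrow> finite (states P m)"
  and finite_observations: "m \<in> {1..M} \<Longrightarrow> finite (observations P m)"
  and init_states: "m \<in> {1..M} \<Longrightarrow> set_pmf (init P m) \<subseteq> states P m"
  and emission_observations:
    "m \<in> {1..M} \<Longrightarrow> s \<in> states P m \<Longrightarrow> set_pmf (emission P m s) \<subseteq> observations P m"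
  and transition_states:
    "m \<in> {1..M} \<Longrightarrow> s \<in> states P m \<Longrightarrow> a \<in> actions P \<Longrightarrow> set_pmf (transition P m s a) \<subseteq> states P m"
  using pomdp by (auto simp: decomposable_pomdp_def)

lemma finite_JO: "finite JO"
  unfolding joint_observations_def by (intro finite_PiE) (auto intro: finite_observations)

lemma policy_actions:
  "\<delta> \<in> policies P \<Longrightarrow> t \<in> {1..T} \<Longrightarrow> ob \<in> JO \<Longrightarrow> set_pmf (\<delta> t ob) \<subseteq> actions P"
  by (auto simp: policies_def)

lemma Pi_pmf_subset_PiE:
  assumes "\<And>m. m \<in> {1..M} \<Longrightarrow> set_pmf (p m) \<subseteq> X m"
  shows "set_pmf (Pi_pmf {1..M} undefined p) \<subseteq> (\<Pi>\<^sub>E m\<in>{1..M}. X m)"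
  using set_Pi_pmf_subset'[of "{1..M}" undefined p] assms by (fastforce simp: PiE_dflt_def PiE_def extensional_def)

lemma finite_joint_states: "finite (joint_states P)"
  unfolding joint_states_def by (intro finite_PiE) (auto intro: finite_states)

lemma joint_statesD: "s \<in> joint_states P \<Longrightarrow> m \<in> {1..M} \<Longrightarrow> s m \<in> states P m"
  by (auto simp: joint_states_def)

lemma joint_init_supp: "set_pmf (joint_init P) \<subseteq> joint_states P"
  unfolding joint_states_def joint_init_def by (intro Pi_pmf_subset_PiE init_states)

lemma joint_emission_supp: "s \<in> joint_states P \<Longrightarrow> set_pmf (joint_emission P s) \<subseteq> JO"
  unfolding joint_observations_def joint_emission_def
  by (intro Pi_pmf_subset_PiE emission_observations joint_statesD)

lemma joint_transition_supp:
  "s \<in> joint_states P \<Longrightarrow> a \<in> actions P \<Longrightarrow> set_pmf (joint_transition P s a) \<subseteq> joint_states P"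
  unfolding joint_transition_def
  by (subst joint_states_def, intro Pi_pmf_subset_PiE transition_states joint_statesD)

lemma run_supp:
  assumes \<delta>: "\<delta> \<in> policies P" and "k \<le> T" and "(S, Ob, A) \<in> set_pmf (run P \<delta> k)"
  shows "(\<forall>t\<in>{1..Suc k}. S t \<in> joint_states P) \<and> (\<forall>t\<in>{1..k}. Ob t \<in> JO \<and> A t \<in> actions P)"
  using assms(2,3)
proof (induction k arbitrary: S Ob A)
  case 0
  then show ?case using joint_init_supp by auto
next
  case (Suc k)
  from Suc.prems obtain S0 Ob0 A0 ob a s' where
    r: "(S0, Ob0, A0) \<in> set_pmf (run P \<delta> k)"
    and ob: "ob \<in> set_pmf (joint_emission P (S0 (Suc k)))" and a: "a \<in> set_pmf (\<delta> (Suc k) ob)"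
    and s': "s' \<in> set_pmf (joint_transition P (S0 (Suc k)) a)"
    and eq: "S = S0(Suc (Suc k) := s')" "Ob = Ob0(Suc k := ob)" "A = A0(Suc k := a)"
    by auto
  have IH: "(\<forall>t\<in>{1..Suc k}. S0 t \<in> joint_states P) \<and> (\<forall>t\<in>{1..k}. Ob0 t \<in> JO \<and> A0 t \<in> actions P)"
    using Suc.IH Suc.prems r by simp
  then have s: "S0 (Suc k) \<in> joint_states P" by simp
  from joint_emission_supp[OF s] ob have obJ: "ob \<in> JO" by auto
  with policy_actions[OF \<delta>, of "Suc k" ob] a Suc.prems have aA: "a \<in> actions P" by auto
  from joint_transition_supp[OF s aA] s' have "s' \<in> joint_states P" by auto
  with IH obJ aA show ?case by (auto simp: eq)
qed

text \<open>
  Finiteness of the support makes every expectation over a run a finite sum, so that integrability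
  is automatic.
\<close>
lemma run_finite:
  assumes \<delta>: "\<delta> \<in> policies P" and "k \<le> T"
  shows "finite (set_pmf (run P \<delta> k))"
  using assms(2)
proof (induction k)
  case 0
  show ?case using finite_subset[OF joint_init_supp finite_joint_states] by simp
next
  case (Suc k)
  have "finite (set_pmf (joint_emission P (S (Suc k))))"
    and "ob \<in> set_pmf (joint_emission P (S (Suc k))) \<Longrightarrow> finite (set_pmf (\<delta> (Suc k) ob))"
    and "ob \<in> set_pmf (joint_emission P (S (Suc k))) \<Longrightarrow> a \<in> set_pmf (\<delta> (Suc k) ob) \<Longrightarrow>
      finite (set_pmf (joint_transition P (S (Suc k)) a))"
    if "(S, Ob, A) \<in> set_pmf (run P \<delta> k)" for S Ob A ob a
  proof -
    have s: "S (Suc k) \<in> joint_states P"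
      using run_supp[OF \<delta> _ that] Suc.prems by auto
    note o = joint_emission_supp[OF s]
    show "finite (set_pmf (joint_emission P (S (Suc k))))"
      using o finite_JO by (rule finite_subset)
    assume "ob \<in> set_pmf (joint_emission P (S (Suc k)))"
    then have a: "set_pmf (\<delta> (Suc k) ob) \<subseteq> actions P"
      using policy_actions[OF \<delta>, of "Suc k"] o Suc.prems by auto
    show "finite (set_pmf (\<delta> (Suc k) ob))"
      using a finite_actions(1) by (rule finite_subset)
    assume "a \<in> set_pmf (\<delta> (Suc k) ob)"
    then show "finite (set_pmf (joint_transition P (S (Suc k)) a))"
      using joint_transition_supp[OF s, of a] a finite_joint_states by (auto intro: finite_subset)
  qed
  with Suc show ?case by (auto 0 3 split: prod.splits)
qed

text \<open>
  Only the decisions at joint observations that can occur, up to the current time, affect a run.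
  Policies are functions on a possibly infinite type, and this is what leaves only finitely many
  essentially different deterministic ones.
\<close>
lemma run_cong:
  assumes \<delta>: "\<delta> \<in> policies P" and "k \<le> T"
    and "\<And>t ob. t \<in> {1..k} \<Longrightarrow> ob \<in> JO \<Longrightarrow> \<delta>' t ob = \<delta> t ob"
  shows "run P \<delta>' k = run P \<delta> k"
  using assms(2,3)
proof (induction k)
  case (Suc k)
  have IH: "run P \<delta>' k = run P \<delta> k" using Suc by simp
  show ?case
    unfolding run.simps IH
  proof (intro bind_pmf_cong refl, clarsimp)
    fix S Ob A assume "(S, Ob, A) \<in> set_pmf (run P \<delta> k)"
    then have "S (Suc k) \<in> joint_states P"
      using run_supp[OF \<delta>, of k S Ob A] Suc.prems by simp
    from joint_emission_supp[OF this] Suc.prems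
    show "joint_emission P (S (Suc k)) \<bind> (\<lambda>ob. \<delta>' (Suc k) ob \<bind> (\<lambda>a. joint_transition P (S (Suc k)) a \<bind>
        (\<lambda>s'. return_pmf (S(Suc (Suc k) := s'), Ob(Suc k := ob), A(Suc k := a))))) =
      joint_emission P (S (Suc k)) \<bind> (\<lambda>ob. \<delta> (Suc k) ob \<bind> (\<lambda>a. joint_transition P (S (Suc k)) a \<bind>
        (\<lambda>s'. return_pmf (S(Suc (Suc k) := s'), Ob(Suc k := ob), A(Suc k := a)))))"
      by (intro bind_pmf_cong) auto
  qed
qed simp

section \<open>Optimality of deterministic policies\<close>

definition override :: "('o, 'a) policy \<Rightarrow> nat \<Rightarrow> (nat \<Rightarrow> 'o) \<Rightarrow> 'a \<Rightarrow> ('o, 'a) policy" where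
  "override \<delta> t ob a = \<delta>(t := (\<delta> t)(ob := return_pmf a))"

lemma override_policy:
  "\<delta> \<in> policies P \<Longrightarrow> a \<in> actions P \<Longrightarrow> override \<delta> t ob a \<in> policies P"
  by (auto simp: policies_def override_def)

text \<open>
  The randomisation at \<open>(t, ob)\<close> may be performed before the run starts.  Steps at times other than
  \<open>t\<close> do not consult it.  At time \<open>t\<close> it is consulted once if \<open>ob\<close> is observed, where drawing it
  early or late makes no difference by commutation of independent draws, and not at all otherwise.
\<close>
lemma run_mixture:
  assumes \<delta>: "\<delta> \<in> policies P" and "k \<le> T"
  shows "run P \<delta> k = \<delta> t ob \<bind> (\<lambda>a. run P (override \<delta> t ob a) k)"
  using assms(2)
proof (induction k)
  case 0
  then show ?case by (simp add: bind_pmf_const)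
next
  case (Suc k)
  let ?em = "\<lambda>z. joint_emission P (fst z (Suc k))"
  define advance where "advance = (\<lambda>(S :: nat \<Rightarrow> nat \<Rightarrow> 's, Ob :: nat \<Rightarrow> nat \<Rightarrow> 'o, A :: nat \<Rightarrow> 'a) ob a.
      joint_transition P (S (Suc k)) a \<bind>
        (\<lambda>s'. return_pmf (S(Suc (Suc k) := s'), Ob(Suc k := ob), A(Suc k := a))))"
  have step: "run P \<delta>' (Suc k) = run P \<delta>' k \<bind> (\<lambda>z. ?em z \<bind> (\<lambda>ob'. \<delta>' (Suc k) ob' \<bind> advance z ob'))"
    for \<delta>'
    unfolding run.simps advance_def by (intro bind_pmf_cong refl) auto
  show ?case
  proof (cases "t = Suc k")
    case False
    then have later: "override \<delta> t ob a (Suc k) = \<delta> (Suc k)" for a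
      by (simp add: override_def)
    have "run P \<delta> (Suc k) = (\<delta> t ob \<bind> (\<lambda>a. run P (override \<delta> t ob a) k)) \<bind>
        (\<lambda>z. ?em z \<bind> (\<lambda>ob'. \<delta> (Suc k) ob' \<bind> advance z ob'))"
      using Suc by (simp only: step)
    then show ?thesis
      by (simp only: step later bind_assoc_pmf)
  next
    case True
    have before: "run P (override \<delta> t ob a) k = run P \<delta> k" for a
      by (rule run_cong[OF \<delta>]) (use Suc.prems True in \<open>auto simp: override_def\<close>)
    have now: "\<delta> t ob \<bind> (\<lambda>a. override \<delta> t ob a (Suc k) ob' \<bind> advance z ob') = \<delta> (Suc k) ob' \<bind> advance z ob'"
      for z ob'
      by (cases "ob' = ob") (simp_all add: override_def True bind_return_pmf bind_pmf_const)
    have "\<delta> t ob \<bind> (\<lambda>a. run P (override \<delta> t ob a) (Suc k)) =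
      run P \<delta> k \<bind> (\<lambda>z. \<delta> t ob \<bind> (\<lambda>a. ?em z \<bind> (\<lambda>ob'. override \<delta> t ob a (Suc k) ob' \<bind> advance z ob')))"
      unfolding step before by (rule bind_commute_pmf)
    also have "\<dots> = run P \<delta> k \<bind> (\<lambda>z. ?em z \<bind> (\<lambda>ob'. \<delta> t ob \<bind> (\<lambda>a. override \<delta> t ob a (Suc k) ob' \<bind> advance z ob')))"
      by (subst bind_commute_pmf[of "\<delta> t ob"]) (rule refl)
    also have "\<dots> = run P \<delta> (Suc k)"
      by (simp only: now step)
    finally show ?thesis ..
  qed
qed

text \<open>
  The expected reward is affine in \<open>\<delta> t ob\<close>, hence on a simplex it is dominated by the value at
  some vertex.
\<close>
lemma override_improves:
  assumes \<delta>: "\<delta> \<in> policies P" and "t \<in> {1..T}" "ob \<in> JO"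
  obtains a where "a \<in> actions P" "expected_reward P \<delta> \<le> expected_reward P (override \<delta> t ob a)"
proof -
  let ?E = "\<lambda>a. expected_reward P (override \<delta> t ob a)"
  have supp: "set_pmf (\<delta> t ob) \<subseteq> actions P"
    using assms by (rule policy_actions)
  have "expected_reward P \<delta> = (\<Sum>a\<in>actions P. pmf (\<delta> t ob) a * ?E a)"
    unfolding expected_reward_def
    by (subst run_mixture[OF \<delta> order_refl, of t ob], subst pmf_expectation_bind[OF finite_actions(1) _ supp])
      (auto intro: run_finite override_policy \<delta>)
  moreover obtain a where a: "a \<in> actions P" "\<And>b. b \<in> actions P \<Longrightarrow> ?E b \<le> ?E a"
    using finite_attains_max[OF finite_actions, of ?E] by blast
  moreover have "(\<Sum>b\<in>actions P. pmf (\<delta> t ob) b * ?E b) \<le> (\<Sum>b\<in>actions P. pmf (\<delta> t ob) b * ?E a)"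
    using a by (intro sum_mono mult_left_mono) auto
  moreover have "(\<Sum>b\<in>actions P. pmf (\<delta> t ob) b * ?E a) = ?E a"
    using sum_pmf_eq_1[OF finite_actions(1) supp] by (simp flip: sum_distrib_right)
  ultimately show ?thesis
    using that by simp
qed

text \<open>
  The decisions in \<open>F\<close> are derandomised one at a time; committing at one pair leaves the earlier
  commitments in place.
\<close>
lemma deterministic_improves:
  assumes \<delta>: "\<delta> \<in> policies P" and "F \<subseteq> {1..T} \<times> JO"
  shows "\<exists>\<delta>'\<in>policies P. expected_reward P \<delta> \<le> expected_reward P \<delta>' \<and>
    (\<forall>(t, ob)\<in>F. \<exists>a\<in>actions P. \<delta>' t ob = return_pmf a)"
proof -
  have "finite F"
    using assms(2) finite_JO by (auto intro: finite_subset)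
  then show ?thesis
    using assms(2)
  proof (induction F)
    case empty
    then show ?case using \<delta> by auto
  next
    case (insert x F)
    obtain t ob where x: "x = (t, ob)" "t \<in> {1..T}" "ob \<in> JO"
      using insert.prems by auto
    obtain \<delta>' where \<delta>': "\<delta>' \<in> policies P" "expected_reward P \<delta> \<le> expected_reward P \<delta>'"
      "\<forall>(t, ob)\<in>F. \<exists>a\<in>actions P. \<delta>' t ob = return_pmf a"
      using insert by auto
    from override_improves[OF \<delta>'(1) x(2,3)] obtain a where
      a: "a \<in> actions P" "expected_reward P \<delta>' \<le> expected_reward P (override \<delta>' t ob a)" .
    show ?case
    proof (intro bexI[of _ "override \<delta>' t ob a"] conjI)
      show "expected_reward P \<delta> \<le> expected_reward P (override \<delta>' t ob a)"
        using \<delta>'(2) a(2) by simp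
      show "\<forall>(t', ob')\<in>insert x F. \<exists>a'\<in>actions P. override \<delta>' t ob a t' ob' = return_pmf a'"
        using \<delta>'(3) a(1) by (auto simp: x override_def)
    qed (intro override_policy \<delta>'(1) a(1))
  qed
qed

text \<open>
  After derandomising all finitely many relevant decisions, a policy is one of finitely many up to
  \<open>run_cong\<close>, and one of these has the largest expected reward.
\<close>
lemma optimal_policy_exists:
  obtains \<delta> where "\<delta> \<in> policies P" "\<And>\<delta>'. \<delta>' \<in> policies P \<Longrightarrow> expected_reward P \<delta>' \<le> expected_reward P \<delta>"
proof -
  define G where "G = ({1..T} \<times> JO \<rightarrow>\<^sub>E actions P)"
  \<comment> \<open>Off the relevant pairs an element of \<open>G\<close> is undefined, but there \<open>policies\<close> demands nothing.\<close>
  define det where "det g = (\<lambda>t ob. return_pmf (g (t, ob)))" for g :: "nat \<times> (nat \<Rightarrow> 'o) \<Rightarrow> 'a"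
  have "finite G" "G \<noteq> {}"
    unfolding G_def using finite_JO finite_actions by (auto intro!: finite_PiE simp: PiE_eq_empty_iff)
  then obtain g where g: "g \<in> G" "\<And>g'. g' \<in> G \<Longrightarrow> expected_reward P (det g') \<le> expected_reward P (det g)"
    using finite_attains_max[of G "\<lambda>g. expected_reward P (det g)"] by blast
  show thesis
  proof (rule that[of "det g"])
    show "det g \<in> policies P"
      using g(1) by (auto simp: det_def G_def policies_def)
    fix \<delta> assume "\<delta> \<in> policies P"
    from deterministic_improves[OF this order_refl] obtain \<delta>' where
      \<delta>': "\<delta>' \<in> policies P" "expected_reward P \<delta> \<le> expected_reward P \<delta>'"
      "\<And>t ob. t \<in> {1..T} \<Longrightarrow> ob \<in> JO \<Longrightarrow> \<exists>a\<in>actions P. \<delta>' t ob = return_pmf a"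
      by fastforce
    define h where "h = (\<lambda>(t, ob)\<in>{1..T} \<times> JO. SOME a. a \<in> actions P \<and> \<delta>' t ob = return_pmf a)"
    have h: "h (t, ob) \<in> actions P \<and> \<delta>' t ob = return_pmf (h (t, ob))" if "t \<in> {1..T}" "ob \<in> JO" for t ob
      using someI_ex[OF \<delta>'(3)[OF that, unfolded Bex_def]] that by (simp add: h_def)
    have "h \<in> G"
      using h unfolding G_def by (auto simp: h_def)
    have "run P (det h) T = run P \<delta>' T"
      using h by (intro run_cong \<delta>'(1)) (auto simp: det_def)
    then have "expected_reward P (det h) = expected_reward P \<delta>'"
      by (simp add: expected_reward_def)
    with \<delta>'(2) g(2)[OF \<open>h \<in> G\<close>] show "expected_reward P \<delta> \<le> expected_reward P (det g)"
      by simp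
  qed
qed

section \<open>Occupation probabilities as LP points\<close>

lemma occupation_feasible:
  assumes \<delta>: "\<delta> \<in> policies P"
  shows "occupation P \<delta> \<in> lp_feasible P"
proof -
  let ?R = "run P \<delta> T"
  have S: "S t m \<in> states P m"
    if "(S, Ob, A) \<in> set_pmf ?R" "m \<in> {1..M}" "t \<in> {1..Suc T}" for S Ob A t m
    using run_supp[OF \<delta> order_refl that(1)] that by (auto intro: joint_statesD)
  have Ob: "Ob t m \<in> observations P m"
    if "(S, Ob, A) \<in> set_pmf ?R" "m \<in> {1..M}" "t \<in> {1..T}" for S Ob A t m
  proof -
    have "Ob t \<in> JO"
      using run_supp[OF \<delta> order_refl that(1)] that(3) by blast
    then show ?thesis
      using that(2) by (auto simp: joint_observations_def)
  qed
  have A: "A t \<in> actions P" if "(S, Ob, A) \<in> set_pmf ?R" "t \<in> {1..T}" for S Ob A t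
    using run_supp[OF \<delta> order_refl that(1)] that by auto
  have "lp_nonneg P (occupation P \<delta>)"
    by (simp add: lp_nonneg_def occupation_def Let_def)
  moreover have "tau_s (occupation P \<delta>) 1 m s = pmf (init P m) s" if m: "m \<in> {1..M}" for m s
  proof -
    have "map_pmf (\<lambda>(S, Ob, A). S 1 m) (run P \<delta> n) = init P m" for n
    proof (induction n)
      case 0
      show ?case
        using Pi_pmf_marginal[OF m, of undefined "init P"] by (simp add: map_pmf_comp joint_init_def)
    next
      case (Suc n)
      then show ?case by (subst run_past) (auto simp: case_prod_unfold)
    qed
    then show ?thesis by (simp add: occupation_def Let_def)
  qed
  moreover
  {
    fix m t assume m: "m \<in> {1..M}" and t: "t \<in> {1..T}"
    then obtain k where k: "t = Suc k" "k < T" by (cases t) auto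
    note E = run_emission[OF m k(2), of \<delta>, folded k(1)]
    note Tr = run_transition[OF m k(2), of \<delta>, folded k(1)]
    have "tau_s (occupation P \<delta>) (t + 1) m s' =
        (\<Sum>s\<in>states P m. \<Sum>a\<in>actions P. pmf (transition P m s a) s' * tau_sa (occupation P \<delta>) t m s a)" for s'
    proof -
      have "tau_s (occupation P \<delta>) (t + 1) m s' =
        (\<Sum>x\<in>states P m \<times> actions P. pmf (map_pmf (\<lambda>(S, Ob, A). ((S t m, A t), S (Suc t) m)) ?R) (x, s'))"
        unfolding occupation_def Let_def lp_vars.simps
        by (rule pmf_marginal[where g = "\<lambda>(S, Ob, A). (S t m, A t)"])
          (use m t S A finite_states[OF m] finite_actions in auto)
      also have "\<dots> = (\<Sum>x\<in>states P m \<times> actions P.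
          pmf (transition P m (fst x) (snd x)) s' * tau_sa (occupation P \<delta>) t m (fst x) (snd x))"
        by (simp add: Tr pmf_bind_map_Pair occupation_def Let_def mult.commute)
      finally show ?thesis
        by (simp add: sum.cartesian_product case_prod_beta)
    qed
    moreover have "tau_sa (occupation P \<delta>) t m s a =
        (\<Sum>ob\<in>observations P m. tau_soa (occupation P \<delta>) t m s ob a)" for s a
      unfolding occupation_def Let_def lp_vars.simps
      by (rule pmf_marginal[where g = "\<lambda>(S, Ob, A). Ob t m"])
        (use m t Ob finite_observations[OF m] in auto)
    moreover have "(\<Sum>s\<in>states P m. tau_sa (occupation P \<delta>) t m s a) = tau_a (occupation P \<delta>) t a" for a
      unfolding occupation_def Let_def lp_vars.simps
      by (rule pmf_marginal[where g = "\<lambda>(S, Ob, A). S t m", symmetric])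
        (use m t S finite_states[OF m] in auto)
    moreover have "(\<Sum>a\<in>actions P. tau_soa (occupation P \<delta>) t m s ob a) =
        pmf (emission P m s) ob * tau_s (occupation P \<delta>) t m s" for s ob
    proof -
      have "(\<Sum>a\<in>actions P. tau_soa (occupation P \<delta>) t m s ob a) =
        pmf (map_pmf (\<lambda>(S, Ob, A). (S t m, Ob t m)) ?R) (s, ob)"
        unfolding occupation_def Let_def lp_vars.simps
        by (rule pmf_marginal[where g = "\<lambda>(S, Ob, A). A t", symmetric])
          (use t A finite_actions in auto)
      then show ?thesis
        by (simp add: E pmf_bind_map_Pair occupation_def Let_def)
    qed
    ultimately have "(\<forall>s'\<in>states P m. tau_s (occupation P \<delta>) (t + 1) m s' =
          (\<Sum>s\<in>states P m. \<Sum>a\<in>actions P. pmf (transition P m s a) s' * tau_sa (occupation P \<delta>) t m s a)) \<and>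
        (\<forall>s\<in>states P m. \<forall>a\<in>actions P. tau_sa (occupation P \<delta>) t m s a =
          (\<Sum>ob\<in>observations P m. tau_soa (occupation P \<delta>) t m s ob a)) \<and>
        (\<forall>a\<in>actions P. (\<Sum>s\<in>states P m. tau_sa (occupation P \<delta>) t m s a) = tau_a (occupation P \<delta>) t a) \<and>
        (\<forall>s\<in>states P m. \<forall>ob\<in>observations P m. (\<Sum>a\<in>actions P. tau_soa (occupation P \<delta>) t m s ob a) =
          pmf (emission P m s) ob * tau_s (occupation P \<delta>) t m s)"
      by blast
  }
  ultimately show ?thesis
    unfolding lp_feasible_def by blast
qed

text \<open>
  One summand of the reward sees only \<open>((s, a), s')\<close> for one component, and the law of this triple is
  the product \<open>\<tau>\<^sub>s\<^sub>a\<close> times the local transition probability.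
\<close>
lemma occupation_objective:
  assumes \<delta>: "\<delta> \<in> policies P"
  shows "lp_objective P (occupation P \<delta>) = expected_reward P \<delta>"
proof -
  let ?R = "run P \<delta> T"
  have int: "integrable (measure_pmf ?R) f" for f :: "_ \<Rightarrow> real"
    by (intro integrable_measure_pmf_finite run_finite \<delta> order_refl)
  have "expected_reward P \<delta> = (\<Sum>t=1..T. \<Sum>m=1..M.
      measure_pmf.expectation ?R (\<lambda>(S, Ob, A). reward P m (S t m) (A t) (S (t + 1) m)))"
    by (simp add: expected_reward_def case_prod_unfold int)
  also have "\<dots> = lp_objective P (occupation P \<delta>)"
    unfolding lp_objective_def
  proof (intro sum.cong refl)
    fix t m assume t: "t \<in> {1..T}" and m: "m \<in> {1..M}"
    then obtain k where k: "t = Suc k" "k < T" by (cases t) auto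
    note Tr = run_transition[OF m k(2), of \<delta>, folded k(1)]
    let ?L = "map_pmf (\<lambda>(S, Ob, A). ((S t m, A t), S (Suc t) m)) ?R"
    let ?g = "\<lambda>((s, a), s'). reward P m s a s'"
    let ?B = "(states P m \<times> actions P) \<times> states P m"
    have "set_pmf ?L \<subseteq> ?B"
    proof safe
      fix s a s' assume "((s, a), s') \<in> set_pmf ?L"
      then obtain S Ob A where *: "(S, Ob, A) \<in> set_pmf ?R" "s = S t m" "a = A t" "s' = S (Suc t) m"
        by auto
      then show "s \<in> states P m" "a \<in> actions P" "s' \<in> states P m"
        using run_supp[OF \<delta> order_refl *(1)] t m by (auto intro: joint_statesD)
    qed
    then have "measure_pmf.expectation ?L ?g = (\<Sum>x\<in>?B. ?g x * pmf ?L x)"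
      using finite_states[OF m] finite_actions by (intro integral_measure_pmf_real) blast+
    also have "\<dots> = (\<Sum>s\<in>states P m. \<Sum>a\<in>actions P. \<Sum>s'\<in>states P m.
        reward P m s a s' * pmf (transition P m s a) s' * tau_sa (occupation P \<delta>) t m s a)"
      by (simp add: sum.cartesian_product' Tr pmf_bind_map_Pair occupation_def Let_def mult_ac)
    also have "\<dots> = (\<Sum>s\<in>states P m. \<Sum>s'\<in>states P m. \<Sum>a\<in>actions P.
        reward P m s a s' * pmf (transition P m s a) s' * tau_sa (occupation P \<delta>) t m s a)"
      by (intro sum.cong refl sum.swap)
    finally show "measure_pmf.expectation ?R (\<lambda>(S, Ob, A). reward P m (S t m) (A t) (S (t + 1) m)) = \<dots>"
      by (simp add: case_prod_unfold)
  qed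
  finally show ?thesis ..
qed

section \<open>Attainment of the LP optimum\<close>

lemma policies_nonempty: "policies P \<noteq> {}"
proof -
  obtain a where "a \<in> actions P" using finite_actions(2) by auto
  then have "(\<lambda>_ _. return_pmf a) \<in> policies P" by (auto simp: policies_def)
  then show ?thesis by auto
qed

text \<open>
  The LP constraints propagate total mass 1 from one time to the next: summing \<open>\<tau>\<^sub>s\<^sub>o\<^sub>a\<close> over \<open>a\<close> and
  \<open>o\<close> gives \<open>\<tau>\<^sub>s\<close>, and the transition law redistributes it without loss.  This bounds the feasible
  region.
\<close>
lemma lp_state_mass:
  assumes \<tau>: "\<tau> \<in> lp_feasible P" and m: "m \<in> {1..M}" and "t \<le> T"
  shows "(\<Sum>s\<in>states P m. tau_s \<tau> (Suc t) m s) = 1"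
  using \<open>t \<le> T\<close>
proof (induction t)
  case 0
  have "(\<Sum>s\<in>states P m. tau_s \<tau> (Suc 0) m s) = (\<Sum>s\<in>states P m. pmf (init P m) s)"
    using \<tau> m by (intro sum.cong) (auto simp: lp_feasible_def)
  then show ?case
    using sum_pmf_eq_1[OF finite_states[OF m] init_states[OF m]] by simp
next
  case (Suc t)
  then have t: "Suc t \<in> {1..T}" by auto
  note feas = \<tau>[unfolded lp_feasible_def mem_Collect_eq, THEN conjunct2, rule_format, OF m, THEN conjunct2, rule_format, OF t]
  have "(\<Sum>s'\<in>states P m. tau_s \<tau> (Suc (Suc t)) m s') =
    (\<Sum>s'\<in>states P m. \<Sum>s\<in>states P m. \<Sum>a\<in>actions P. pmf (transition P m s a) s' * tau_sa \<tau> (Suc t) m s a)"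
    using feas by (intro sum.cong) auto
  also have "\<dots> = (\<Sum>s\<in>states P m. \<Sum>a\<in>actions P. \<Sum>s'\<in>states P m. pmf (transition P m s a) s' * tau_sa \<tau> (Suc t) m s a)"
    by (subst sum.swap, intro sum.cong refl, rule sum.swap)
  also have "\<dots> = (\<Sum>s\<in>states P m. \<Sum>a\<in>actions P. tau_sa \<tau> (Suc t) m s a)"
    using sum_pmf_eq_1[OF finite_states[OF m] transition_states[OF m]]
    by (intro sum.cong refl) (simp flip: sum_distrib_right)
  also have "\<dots> = (\<Sum>s\<in>states P m. \<Sum>ob\<in>observations P m. \<Sum>a\<in>actions P. tau_soa \<tau> (Suc t) m s ob a)"
    using feas by (intro sum.cong refl) (subst sum.swap, auto)
  also have "\<dots> = (\<Sum>s\<in>states P m. \<Sum>ob\<in>observations P m. pmf (emission P m s) ob * tau_s \<tau> (Suc t) m s)"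
    using feas by (intro sum.cong refl) auto
  also have "\<dots> = (\<Sum>s\<in>states P m. tau_s \<tau> (Suc t) m s)"
    using sum_pmf_eq_1[OF finite_observations[OF m] emission_observations[OF m]]
    by (intro sum.cong refl) (simp flip: sum_distrib_right)
  finally show ?case using Suc by simp
qed

lemma lp_soa_bounds:
  assumes \<tau>: "\<tau> \<in> lp_feasible P" and m: "m \<in> {1..M}" and t: "t \<in> {1..T}"
    and s: "s \<in> states P m" and ob: "ob \<in> observations P m" and a: "a \<in> actions P"
  shows "tau_soa \<tau> t m s ob a \<in> {0..1}"
proof -
  have nonneg: "lp_nonneg P \<tau>" using \<tau> by (simp add: lp_feasible_def)
  have ts: "0 \<le> tau_s \<tau> t m s'" if "s' \<in> states P m" for s'
    using nonneg that m t by (auto simp: lp_nonneg_def)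
  have soa: "0 \<le> tau_soa \<tau> t m s ob b" if "b \<in> actions P" for b
    using nonneg that m t s ob by (auto simp: lp_nonneg_def)
  have "tau_soa \<tau> t m s ob a \<le> (\<Sum>b\<in>actions P. tau_soa \<tau> t m s ob b)"
    using soa a finite_actions by (intro member_le_sum) auto
  also have "\<dots> = pmf (emission P m s) ob * tau_s \<tau> t m s"
    using \<tau> m t s ob by (auto simp: lp_feasible_def)
  also have "\<dots> \<le> tau_s \<tau> t m s"
    using ts[OF s] by (simp add: mult_left_le_one_le pmf_le_1)
  also have "\<dots> \<le> (\<Sum>s\<in>states P m. tau_s \<tau> t m s)"
    using ts s finite_states[OF m] by (intro member_le_sum) auto
  also have "\<dots> = 1"
    using lp_state_mass[OF \<tau> m, of "t - 1"] t by (cases t) auto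
  finally show ?thesis using soa[OF a] by simp
qed

text \<open>
  Values of an LP point outside the index ranges are arbitrary, so a feasible point is recovered
  from its \<open>\<tau>\<^sub>s\<^sub>o\<^sub>a\<close> only on the index ranges; feasibility and objective see no more than that.  With
  no component at all, no constraint would tie \<open>\<tau>\<^sub>a\<close> to the other variables, hence \<open>1 \<le> num_components P\<close>.
\<close>
lemma lp_extend_represents:
  assumes \<tau>: "\<tau> \<in> lp_feasible P" and "1 \<le> M"
    and x: "\<And>t m s ob a. \<lbrakk>t \<in> {1..T}; m \<in> {1..M}; s \<in> states P m; ob \<in> observations P m; a \<in> actions P\<rbrakk> \<Longrightarrow>
      x (t, m, s, ob, a) = tau_soa \<tau> t m s ob a"
  shows "lp_extend P x \<in> lp_feasible P" "lp_objective P (lp_extend P x) = lp_objective P \<tau>"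
proof -
  have soa: "tau_soa (lp_extend P x) t m s ob a = tau_soa \<tau> t m s ob a"
    if "t \<in> {1..T}" "m \<in> {1..M}" "s \<in> states P m" "ob \<in> observations P m" "a \<in> actions P" for t m s ob a
    using x that by (simp add: lp_extend_def Let_def)
  have sa: "tau_sa (lp_extend P x) t m s a = tau_sa \<tau> t m s a"
    if "t \<in> {1..T}" "m \<in> {1..M}" "s \<in> states P m" "a \<in> actions P" for t m s a
    using x that \<tau> by (simp add: lp_extend_def Let_def lp_feasible_def)
  have ts: "tau_s (lp_extend P x) t m s = tau_s \<tau> t m s"
    if t: "t \<in> {1..T + 1}" and m: "m \<in> {1..M}" and s: "s \<in> states P m" for t m s
  proof (cases "t = 1")
    case True
    then show ?thesis using \<tau> m s by (simp add: lp_extend_def Let_def lp_feasible_def)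
  next
    case False
    with t obtain k where k: "t = k + 1" "k \<in> {1..T}" by (cases t) auto
    have "tau_s (lp_extend P x) t m s =
      (\<Sum>s0\<in>states P m. \<Sum>a\<in>actions P. pmf (transition P m s0 a) s * tau_sa (lp_extend P x) k m s0 a)"
      using False k(1) by (simp add: lp_extend_def Let_def)
    also have "\<dots> = (\<Sum>s0\<in>states P m. \<Sum>a\<in>actions P. pmf (transition P m s0 a) s * tau_sa \<tau> k m s0 a)"
      using k(2) m by (intro sum.cong refl) (simp add: sa)
    also have "\<dots> = tau_s \<tau> t m s"
      using \<tau> m s k by (simp add: lp_feasible_def)
    finally show ?thesis .
  qed
  have ta: "tau_a (lp_extend P x) t a = tau_a \<tau> t a" if "t \<in> {1..T}" "a \<in> actions P" for t a
  proof -
    have "tau_a (lp_extend P x) t a = (\<Sum>s\<in>states P 1. tau_sa (lp_extend P x) t 1 s a)"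
      by (simp add: lp_extend_def Let_def)
    also have "\<dots> = (\<Sum>s\<in>states P 1. tau_sa \<tau> t 1 s a)"
      using that \<open>1 \<le> M\<close> by (intro sum.cong refl sa) auto
    also have "\<dots> = tau_a \<tau> t a"
    proof -
      have "1 \<in> {1..M}" using \<open>1 \<le> M\<close> by simp
      with \<tau> that show ?thesis unfolding lp_feasible_def by blast
    qed
    finally show ?thesis .
  qed
  show "lp_extend P x \<in> lp_feasible P"
  proof -
    have "lp_extend P x \<in> lp_feasible P \<longleftrightarrow> \<tau> \<in> lp_feasible P"
      by (simp add: lp_feasible_def lp_nonneg_def soa sa ts ta cong: sum.cong)
    with \<tau> show ?thesis by simp
  qed
  show "lp_objective P (lp_extend P x) = lp_objective P \<tau>"
    unfolding lp_objective_def by (intro sum.cong refl) (simp add: sa)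
qed

lemma lp_optimum_exists:
  obtains \<tau> where "\<tau> \<in> lp_feasible P" "\<And>\<sigma>. \<sigma> \<in> lp_feasible P \<Longrightarrow> lp_objective P \<sigma> \<le> lp_objective P \<tau>"
proof -
  obtain \<tau>0 where \<tau>0: "\<tau>0 \<in> lp_feasible P"
    using policies_nonempty occupation_feasible by blast
  show thesis
  proof (cases "M = 0")
    case True
    \<comment> \<open>The objective is an empty sum; no constraint bounds \<open>\<tau>\<^sub>a\<close>, so compactness is not available.\<close>
    then show thesis
      by (intro that[OF \<tau>0]) (simp add: lp_objective_def)
  next
    case False
    define I where "I = {(t, m, s, ob, a). t \<in> {1..T} \<and> m \<in> {1..M} \<and> s \<in> states P m \<and>
      ob \<in> observations P m \<and> a \<in> actions P}"
    \<comment> \<open>Coordinates outside the index ranges are pinned to 0, which makes the box compact.\<close>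
    define K where "K = Pi UNIV (\<lambda>i. if i \<in> I then {0..1 :: real} else {0}) \<inter> {x. lp_extend P x \<in> lp_feasible P}"
    have "compact K"
      unfolding K_def by (intro compact_Int_closed compact_Pi_UNIV lp_extend_feasible_closed) auto
    have repr: "\<exists>x\<in>K. lp_objective P (lp_extend P x) = lp_objective P \<tau>" if \<tau>: "\<tau> \<in> lp_feasible P" for \<tau>
    proof -
      define x where "x i = (if i \<in> I then (case i of (t, m, s, ob, a) \<Rightarrow> tau_soa \<tau> t m s ob a) else 0)" for i
      note ext = lp_extend_represents[OF \<tau>, of x]
      have "lp_extend P x \<in> lp_feasible P" "lp_objective P (lp_extend P x) = lp_objective P \<tau>"
        using False by (auto intro!: ext simp: x_def I_def)
      moreover have "x i \<in> (if i \<in> I then {0..1} else {0})" for i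
        using lp_soa_bounds[OF \<tau>] by (cases i) (auto simp: x_def I_def)
      ultimately show ?thesis
        unfolding K_def by blast
    qed
    have "K \<noteq> {}" using repr[OF \<tau>0] by auto
    then obtain x where x: "x \<in> K" "\<And>y. y \<in> K \<Longrightarrow> lp_objective P (lp_extend P y) \<le> lp_objective P (lp_extend P x)"
      using continuous_attains_sup[OF \<open>compact K\<close> _
          continuous_on_subset[OF lp_objective_extend_continuous subset_UNIV]] by blast
    show thesis
    proof (rule that)
      show "lp_extend P x \<in> lp_feasible P" using x(1) by (simp add: K_def)
      show "lp_objective P \<sigma> \<le> lp_objective P (lp_extend P x)" if "\<sigma> \<in> lp_feasible P" for \<sigma>
        using repr[OF that] x(2) by metis
    qed
  qed
qed

end

theorem theorem3:
  fixes P :: "('s, 'o, 'a) dpomdp"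
  assumes "decomposable_pomdp P"
  shows "(\<forall>\<delta>\<in>policies P. \<exists>\<tau>\<in>lp_feasible P. expected_reward P \<delta> \<le> lp_objective P \<tau>)
    \<and> (\<exists>\<delta>. is_arg_max (expected_reward P) (\<lambda>\<delta>. \<delta> \<in> policies P) \<delta>)
    \<and> (\<exists>\<tau>. is_arg_max (lp_objective P) (\<lambda>\<tau>. \<tau> \<in> lp_feasible P) \<tau>)
    \<and> v_star P \<le> z_star P"
proof -
  have relax: "\<exists>\<tau>\<in>lp_feasible P. expected_reward P \<delta> \<le> lp_objective P \<tau>" if "\<delta> \<in> policies P" for \<delta>
    using occupation_feasible[OF assms that] occupation_objective[OF assms that]
    by (intro bexI[of _ "occupation P \<delta>"]) simp_all
  obtain \<delta> where \<delta>: "\<delta> \<in> policies P"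
    "\<And>\<delta>'. \<delta>' \<in> policies P \<Longrightarrow> expected_reward P \<delta>' \<le> expected_reward P \<delta>"
    using optimal_policy_exists[OF assms] by blast
  obtain \<tau> where \<tau>: "\<tau> \<in> lp_feasible P"
    "\<And>\<sigma>. \<sigma> \<in> lp_feasible P \<Longrightarrow> lp_objective P \<sigma> \<le> lp_objective P \<tau>"
    using lp_optimum_exists[OF assms] by blast
  have "v_star P = expected_reward P \<delta>"
    unfolding v_star_def using \<delta> by (intro Greatest_equality) auto
  moreover have "z_star P = lp_objective P \<tau>"
    unfolding z_star_def using \<tau> by (intro Greatest_equality) auto
  moreover have "expected_reward P \<delta> \<le> lp_objective P \<tau>"
    using relax[OF \<delta>(1)] \<tau>(2) order_trans by blast
  ultimately show ?thesis
    using relax \<delta> \<tau> by (auto simp: is_arg_max_linorder)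
qed

end
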